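(* For every even integer $n \geq 10$, there exists a chemical edge transmission irregular (ETI) graph of order $n$.
   Context: All graphs are finite, simple and undirected. The order of a graph is its number of vertices. A chemical graph is a connected graph with maximum degree at most $4$. For a connected graph $G$ and $v \in V(G)$, the transmission of $v$ is $\mathrm{Tr}_G(v) = \sum_{u \in V(G)} d_G(v,u)$, where $d_G$ is the shortest-path distance. For an edge $e = uv \in E(G)$, the transmission of $e$ is $\mathrm{Tr}_G(e) = \mathrm{Tr}_G(u) + \mathrm{Tr}_G(v)$. A connected graph $G$ is edge transmission irregular (ETI) if any two distinct edges of $G$ have different transmissions. *)

theory Defs
  imports "Graph_Theory.Graph_Theory"
begin

text \<open>
  A finite simple undirected graph is a \<open>pair_graph\<close>, i.e. a finite, loop-free, symmetric digraph
  whose arcs are ordered pairs of vertices; the undirected edge \<open>uv\<close> is the pair of arcs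
  \<open>(u, v)\<close>, \<open>(v, u)\<close>.  Undirected edges are recovered as two-element sets, so that
  ``distinct edges'' does not distinguish the two orientations of one edge.
\<close>

definition uedges :: "'a pair_pre_digraph \<Rightarrow> 'a set set" where
  "uedges G = {{u, v} | u v. (u, v) \<in> parcs G}"

text \<open>In a symmetric digraph the out-degree of a vertex is its degree as an undirected graph.
  Connected graphs are nonempty.\<close>

definition chemical_graph :: "'a pair_pre_digraph \<Rightarrow> bool" where
  "chemical_graph G \<longleftrightarrow>
     pair_graph G \<and> connected G \<and> (\<forall>v \<in> pverts G. out_degree G v \<le> 4)"

text \<open>The number of edges of a shortest walk; unspecified if \<open>v\<close> is not reachable from \<open>u\<close>.\<close>

definition graph_dist :: "'a pair_pre_digraph \<Rightarrow> 'a \<Rightarrow> 'a \<Rightarrow> nat" where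
  "graph_dist G u v = (LEAST k. \<exists>p. pre_digraph.awalk G u p v \<and> length p = k)"

definition transmission :: "'a pair_pre_digraph \<Rightarrow> 'a \<Rightarrow> nat" where
  "transmission G v = (\<Sum>u \<in> pverts G. graph_dist G v u)"

definition edge_transmission :: "'a pair_pre_digraph \<Rightarrow> 'a set \<Rightarrow> nat" where
  "edge_transmission G e = (\<Sum>v \<in> e. transmission G v)"

definition edge_transmission_irregular :: "'a pair_pre_digraph \<Rightarrow> bool" where
  "edge_transmission_irregular G \<longleftrightarrow>
     pair_graph G \<and> connected G \<and>
     (\<forall>e \<in> uedges G. \<forall>f \<in> uedges G. e \<noteq> f \<longrightarrow> edge_transmission G e \<noteq> edge_transmission G f)"

lemma (in pair_graph) edge_transmission_arc:
  assumes "(u, v) \<in> parcs G"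
  shows "edge_transmission G {u, v} = transmission G u + transmission G v"
  using no_loops'[OF assms] by (simp add: edge_transmission_def)

lemma (in pair_wf_digraph) out_degree_eq_card_neighbours:
  "out_degree G v = card {u. (v, u) \<in> parcs G}"
proof -
  have "out_arcs G v = Pair v ` {u. (v, u) \<in> parcs G}"
    by (auto simp: out_arcs_def)
  then show ?thesis
    by (simp add: out_degree_def card_image inj_on_def)
qed

text \<open>Agreement with the library's weighted shortest-path distance for unit weights.\<close>

lemma (in pair_wf_digraph) graph_dist_eq_mu:
  assumes "awalk u q v"
  shows "ereal (real (graph_dist G u v)) = \<mu> (\<lambda>_. 1) u v"
proof -
  have cost: "awalk_cost (\<lambda>_. 1) p = real (length p)" for p
    by (simp add: awalk_cost_def sum_list_triv)
  have "\<exists>p. awalk u p v \<and> length p = graph_dist G u v"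
    unfolding graph_dist_def by (rule LeastI_ex) (use assms in blast)
  then obtain p where p: "awalk u p v" "length p = graph_dist G u v"
    by blast
  have least: "graph_dist G u v \<le> length p'" if "awalk u p' v" for p'
    unfolding graph_dist_def by (rule Least_le) (use that in blast)
  show ?thesis
  proof (rule antisym)
    show "ereal (real (graph_dist G u v)) \<le> \<mu> (\<lambda>_. 1) u v"
      unfolding \<mu>_def by (rule INF_greatest) (simp add: cost least)
    show "\<mu> (\<lambda>_. 1) u v \<le> ereal (real (graph_dist G u v))"
      using min_cost_le_walk_cost[OF p(1), of "\<lambda>_. 1"] by (simp add: cost p(2))
  qed
qed

end

theory Submission
  imports Defs
begin

text \<open>
  Distances in an explicit graph are checked through a certificate: a function \<open>d\<close> that vanishes on
  the diagonal, drops by at most one along an arc, and always admits a neighbour strictly closer to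
  the target is the distance function.  The first two properties bound every walk from below, the
  third one produces a walk that attains the bound, and connectedness comes for free.

  For \<open>n = 2 * k + 12\<close> the graph is a path \<open>0, \<dots>, 2 * k + 8\<close> with a small modification around its
  middle: an additional path of length three runs from \<open>k + 1\<close> to \<open>k + 4\<close> parallel to the one on the
  spine, which makes a hexagon, and one additional vertex is joined to \<open>k\<close>, \<open>k + 1\<close> and \<open>k + 2\<close>.
  Each of the three additional vertices lies on a geodesic between the ends of the spine and thereby
  has a position on it.  The distance of two vertices is the difference of their positions, apart from
  a correction for finitely many pairs in the middle whose size is independent of \<open>k\<close>.  Hence the
  transmissions form a quadratic function along each of the two bare arms, and over the
  constant \<open>Q = k\<^sup>2 + 9 * k + 24\<close> the transmissions in the middle do not depend on \<open>k\<close>.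

  Why do the edges have different transmissions?  An edge of the longer arm has transmission
  \<open>2 * Q + 2 * y\<^sup>2\<close> with \<open>y \<ge> 2\<close>, an edge of the shorter arm \<open>2 * Q + 2 * z\<^sup>2 - 24\<close> with \<open>z \<ge> 6\<close>, and
  the ten edges in the middle have \<open>2 * Q + c\<close> for ten distinct constants \<open>c < 30\<close>.  Along one arm
  the values are strictly monotone.  Two arms could only clash if \<open>z\<^sup>2 - y\<^sup>2 = 12\<close>, whose only solution
  \<open>z = 4\<close>, \<open>y = 2\<close> is out of range.  This is the purpose of the modification: the two arms of a bare path
  are mirror images with equal transmissions.  Against the middle only the
  values \<open>8\<close> and \<open>18\<close> of the longer arm are small enough, and neither is among the constants.

  The order \<open>10\<close> is too small for this family; there a path on eight vertices with two pendant
  vertices does the job.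
\<close>

section \<open>Distances from certificates\<close>

text \<open>
  Listing each undirected edge in one orientation only makes injectivity of the edge transmissions a
  plain \<open>inj_on\<close> statement about pairs.
\<close>
definition graph_of :: "nat \<Rightarrow> (nat \<times> nat) set \<Rightarrow> nat pair_pre_digraph" where
  "graph_of n A = \<lparr>pverts = {..<n}, parcs = A \<union> A\<inverse>\<rparr>"

lemma graph_of_simps [simp]:
  "pverts (graph_of n A) = {..<n}"
  "parcs (graph_of n A) = A \<union> A\<inverse>"
  by (simp_all add: graph_of_def)

lemma pair_graph_graph_of:
  assumes "\<And>u v. (u, v) \<in> A \<Longrightarrow> u < n \<and> v < n \<and> u \<noteq> v"
  shows "pair_graph (graph_of n A)"
proof -
  have "A \<subseteq> {..<n} \<times> {..<n}"
    using assms by auto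
  then have "finite A"
    by (rule finite_subset) simp
  then show ?thesis
    by unfold_locales (auto simp: symmetric_def sym_def dest: assms)
qed

context pair_wf_digraph
begin

text \<open>
  A function that drops by at most one per arc cannot reach \<open>0\<close> in fewer steps than its value: the
  lower bound for distances.
\<close>
lemma le_length_if_lipschitz:
  fixes d :: "'a \<Rightarrow> nat"
  assumes "awalk u p v" and "d v = 0"
    and "\<And>u w. (u, w) \<in> parcs G \<Longrightarrow> d u \<le> d w + 1"
  shows "d u \<le> length p"
  using assms(1)
proof (induction p arbitrary: u)
  case Nil
  then show ?case using assms(2) by (simp add: awalk_Nil_iff)
next
  case (Cons e p)
  then have "e \<in> parcs G" "u = fst e" "d (snd e) \<le> length p"
    by (auto simp: awalk_Cons_iff)
  then show ?case using assms(3)[of "fst e" "snd e"] by simp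
qed

text \<open>
  Following strictly decreasing arcs must end at \<open>v\<close>: the upper bound for distances.
\<close>
lemma awalk_by_descent:
  fixes d :: "'a \<Rightarrow> nat"
  assumes "\<And>u. u \<in> pverts G \<Longrightarrow> u \<noteq> v \<Longrightarrow> \<exists>w. (u, w) \<in> parcs G \<and> d w < d u"
    and "u \<in> pverts G"
  shows "\<exists>p. awalk u p v \<and> length p \<le> d u"
  using assms(2)
proof (induction "d u" arbitrary: u rule: less_induct)
  case less
  show ?case
  proof (cases "u = v")
    case True
    then have "awalk u [] v" using less.prems by (simp add: awalk_Nil_iff)
    then show ?thesis by (intro exI[of _ "[]"]) simp
  next
    case False
    then obtain w where w: "(u, w) \<in> parcs G" "d w < d u"
      using assms(1) less.prems by blast
    then obtain p where "awalk w p v" "length p \<le> d w"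
      using less.hyps[of w] by (auto dest: in_arcsD2)
    then show ?thesis
      using w by (intro exI[of _ "(u, w) # p"]) (auto simp: awalk_Cons_iff)
  qed
qed

lemma graph_dist_eqI:
  fixes d :: "'a \<Rightarrow> 'a \<Rightarrow> nat"
  assumes "d v v = 0"
    and "\<And>u w. (u, w) \<in> parcs G \<Longrightarrow> d u v \<le> d w v + 1"
    and "\<And>u. u \<in> pverts G \<Longrightarrow> u \<noteq> v \<Longrightarrow> \<exists>w. (u, w) \<in> parcs G \<and> d w v < d u v"
    and "u \<in> pverts G"
  shows "graph_dist G u v = d u v"
proof -
  have lower: "d u v \<le> length p" if "awalk u p v" for p
    using le_length_if_lipschitz[of u p v "\<lambda>u. d u v"] that assms(1,2) by blast
  obtain p where "awalk u p v" "length p \<le> d u v"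
    using awalk_by_descent[of v "\<lambda>u. d u v" u] assms(3,4) by blast
  then show ?thesis
    unfolding graph_dist_def using lower
    by (intro Least_equality) (auto intro: antisym)
qed

end

definition metric_certificate :: "'a pair_pre_digraph \<Rightarrow> ('a \<Rightarrow> 'a \<Rightarrow> nat) \<Rightarrow> bool" where
  "metric_certificate G d \<longleftrightarrow> (\<forall>v \<in> pverts G.
     d v v = 0 \<and>
     (\<forall>(u, w) \<in> parcs G. d u v \<le> d w v + 1) \<and>
     (\<forall>u \<in> pverts G. u \<noteq> v \<longrightarrow> (\<exists>w. (u, w) \<in> parcs G \<and> d w v < d u v)))"

lemma connected_if_metric_certificate:
  assumes "pair_graph G" and "metric_certificate G d" and "pverts G \<noteq> {}"
  shows "connected G"
proof -
  interpret pair_graph G by fact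
  have "u \<rightarrow>\<^sup>*\<^bsub>G\<^esub> v" if "u \<in> pverts G" "v \<in> pverts G" for u v
    using awalk_by_descent[of v "\<lambda>u. d u v" u] assms(2) that
    unfolding metric_certificate_def by (auto simp: reachable_awalk)
  then have "strongly_connected G"
    using assms(3) by (intro strongly_connectedI) auto
  then show ?thesis
    unfolding connected_def strongly_connected_def
    using reachable_mk_symmetric_eq[OF pair_sym_arcs] by simp
qed

lemma transmission_if_metric_certificate:
  assumes "pair_graph G" and "metric_certificate G d" and "v \<in> pverts G"
  shows "transmission G v = (\<Sum>u \<in> pverts G. d v u)"
proof -
  interpret pair_graph G by fact
  show ?thesis
    unfolding transmission_def
  proof (rule sum.cong[OF refl])
    fix u assume "u \<in> pverts G"
    then show "graph_dist G v u = d v u"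
      using assms(2,3) unfolding metric_certificate_def
      by (intro graph_dist_eqI) auto
  qed
qed

text \<open>
  The interface to the two constructions below.  Everything that it asks for is an elementary statement
  about numbers; walks no longer occur.
\<close>
lemma chemical_eti_graph_of:
  assumes "n > 0"
    and bounds: "\<And>u v. (u, v) \<in> A \<Longrightarrow> u < n \<and> v < n \<and> u \<noteq> v"
    and deg: "\<And>v. v < n \<Longrightarrow> card {u. (u, v) \<in> A \<or> (v, u) \<in> A} \<le> 4"
    and d: "metric_certificate (graph_of n A) d"
    and tr: "\<And>v. v < n \<Longrightarrow> (\<Sum>u<n. d v u) = t v"
    and inj: "inj_on (\<lambda>(u, v). t u + t v) A"
  shows "\<exists>G :: nat pair_pre_digraph.
    chemical_graph G \<and> edge_transmission_irregular G \<and> card (pverts G) = n"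
proof -
  let ?G = "graph_of n A"
  have G: "pair_graph ?G"
    using bounds by (rule pair_graph_graph_of)
  interpret pair_graph ?G by fact
  have conn: "connected ?G"
    using G d by (rule connected_if_metric_certificate) (use \<open>n > 0\<close> in auto)
  have "out_degree ?G v \<le> 4" if "v < n" for v
    unfolding out_degree_eq_card_neighbours using deg[OF that] by (simp add: disj_commute)
  then have chem: "chemical_graph ?G"
    using G conn by (simp add: chemical_graph_def)
  have et: "edge_transmission ?G {u, v} = t u + t v" if "(u, v) \<in> A" for u v
    using that bounds[OF that] edge_transmission_arc[of u v] tr
    by (simp add: transmission_if_metric_certificate[OF G d])
  have ue: "\<exists>u v. (u, v) \<in> A \<and> e = {u, v}" if "e \<in> uedges ?G" for e
    using that by (auto simp: uedges_def insert_commute)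
  have "e = f" if e: "e \<in> uedges ?G" and f: "f \<in> uedges ?G"
    and eq: "edge_transmission ?G e = edge_transmission ?G f" for e f
  proof -
    obtain u v x y where *: "(u, v) \<in> A" "e = {u, v}" "(x, y) \<in> A" "f = {x, y}"
      using ue[OF e] ue[OF f] by blast
    then have "t u + t v = t x + t y"
      using et eq by simp
    then have "(u, v) = (x, y)"
      using inj_onD[OF inj, of "(u, v)" "(x, y)"] * by simp
    then show ?thesis using * by simp
  qed
  then have "edge_transmission_irregular ?G"
    using G conn unfolding edge_transmission_irregular_def by blast
  then show ?thesis using chem by (intro exI[of _ ?G]) simp
qed

section \<open>A path with a modified middle\<close>

definition gap :: "nat \<Rightarrow> nat \<Rightarrow> nat" where
  "gap p q = (p - q) + (q - p)"

lemma gap_sum_path: "2 * (\<Sum>j<Suc (p + r). gap p j) = p * Suc p + r * Suc r"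
proof (induction r)
  case 0
  have "2 * (\<Sum>j<Suc p. p - j) = p * Suc p"
  proof (induction p)
    case (Suc p)
    have "(\<Sum>j<Suc (Suc p). Suc p - j) = Suc p + (\<Sum>j<Suc p. p - j)"
      by (subst sum.lessThan_Suc_shift) simp
    then show ?case using Suc.IH by simp
  qed simp
  moreover have "(\<Sum>j<Suc p. gap p j) = (\<Sum>j<Suc p. p - j)"
    by (rule sum.cong) (auto simp: gap_def)
  ultimately show ?case by simp
next
  case (Suc r)
  then show ?case by (simp add: gap_def)
qed

text \<open>
  The spine is \<open>0, \<dots>, 2 * k + 8\<close>.  The hexagon is
  \<open>k + 1, k + 2, k + 3, k + 4, 2 * k + 11, 2 * k + 10\<close>, and \<open>2 * k + 9\<close> is joined to \<open>k + 1\<close>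
  and its two neighbours on the spine.
\<close>
definition hexpath_edges :: "nat \<Rightarrow> (nat \<times> nat) set" where
  "hexpath_edges k = {(i, Suc i) | i. i < 2 * k + 8} \<union>
     {(k, 2 * k + 9), (k + 1, 2 * k + 9), (k + 2, 2 * k + 9),
      (k + 1, 2 * k + 10), (2 * k + 10, 2 * k + 11), (k + 4, 2 * k + 11)}"

text \<open>
  The vertices \<open>2 * k + 9\<close>, \<open>2 * k + 10\<close>, \<open>2 * k + 11\<close> are placed at \<open>k + 1\<close>, \<open>k + 2\<close>, \<open>k + 3\<close>: these are
  their distances from the end \<open>0\<close> of the spine.
\<close>
definition hexpath_pos :: "nat \<Rightarrow> nat \<Rightarrow> nat" where
  "hexpath_pos k v = (if v \<le> 2 * k + 8 then v else v - (k + 8))"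

text \<open>
  The excess of the distance over the difference of positions.  It is \<open>2\<close> between the two sides of the
  hexagon, where one has to go back to a common neighbour or around the far end.
\<close>
definition hexpath_detour :: "nat \<Rightarrow> nat \<Rightarrow> nat \<Rightarrow> nat" where
  "hexpath_detour k u v =
     (if u = 2 * k + 9 \<and> v \<in> {k + 1, 2 * k + 10, 2 * k + 11} \<or>
         v = 2 * k + 9 \<and> u \<in> {k + 1, 2 * k + 10, 2 * k + 11} then 1
      else if u \<in> {k + 2, k + 3} \<and> v \<in> {2 * k + 10, 2 * k + 11} \<or>
              v \<in> {k + 2, k + 3} \<and> u \<in> {2 * k + 10, 2 * k + 11} then 2
      else 0)"

definition hexpath_dist :: "nat \<Rightarrow> nat \<Rightarrow> nat \<Rightarrow> nat" where
  "hexpath_dist k u v = gap (hexpath_pos k u) (hexpath_pos k v) + hexpath_detour k u v"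

text \<open>
  The transmissions in closed form.  The minimum, \<open>2\<close> above the common constant, lies at \<open>k + 4\<close>.  The
  growth is slower on the right, along the longer arm; this asymmetry separates the two arms.
\<close>
definition hexpath_transmission :: "nat \<Rightarrow> nat \<Rightarrow> nat" where
  "hexpath_transmission k v = k\<^sup>2 + 9 * k + 24 +
     (if v = k + 1 then 9 else if v = 2 * k + 9 then 11
      else if v = k + 2 then 6 else if v = 2 * k + 10 then 7
      else if v = k + 3 then 4 else if v = 2 * k + 11 then 5
      else if v \<le> k then (k - v + 2) * (k - v + 9)
      else (v - (k + 3)) * (v - (k + 2)))"

lemma hexpath_edges_bounds:
  "(u, v) \<in> hexpath_edges k \<Longrightarrow> u < 2 * k + 12 \<and> v < 2 * k + 12 \<and> u \<noteq> v"
  by (auto simp: hexpath_edges_def)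

lemma hexpath_dist_self: "hexpath_dist k v v = 0"
  by (auto simp: hexpath_dist_def gap_def hexpath_detour_def)

lemma hexpath_dist_commute: "hexpath_dist k u v = hexpath_dist k v u"
  by (auto simp: hexpath_dist_def gap_def hexpath_detour_def)

text \<open>
  Distances to a vertex of the spine, one equation for each kind of source.  Case analyses below use these
  instead of the definition, whose nested conditionals would multiply the number of cases.
\<close>
lemma hexpath_dist_to_spine:
  assumes "v \<le> 2 * k + 8"
  shows "u \<le> 2 * k + 8 \<Longrightarrow> hexpath_dist k u v = gap u v"
    and "hexpath_dist k (2 * k + 9) v = gap (k + 1) v + (if v = k + 1 then 1 else 0)"
    and "hexpath_dist k (2 * k + 10) v = gap (k + 2) v + (if v = k + 2 \<or> v = k + 3 then 2 else 0)"
    and "hexpath_dist k (2 * k + 11) v = gap (k + 3) v + (if v = k + 2 \<or> v = k + 3 then 2 else 0)"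
  using assms by (auto simp: hexpath_dist_def hexpath_pos_def hexpath_detour_def add.commute)

lemma hexpath_dist_extra:
  "hexpath_dist k (2 * k + 9) (2 * k + 10) = 2" "hexpath_dist k (2 * k + 10) (2 * k + 9) = 2"
  "hexpath_dist k (2 * k + 9) (2 * k + 11) = 3" "hexpath_dist k (2 * k + 11) (2 * k + 9) = 3"
  "hexpath_dist k (2 * k + 10) (2 * k + 11) = 1" "hexpath_dist k (2 * k + 11) (2 * k + 10) = 1"
  by (simp_all add: hexpath_dist_def hexpath_pos_def hexpath_detour_def gap_def)

lemma hexpath_dist_from_spine:
  assumes "v \<le> 2 * k + 8"
  shows "hexpath_dist k v (2 * k + 9) = gap (k + 1) v + (if v = k + 1 then 1 else 0)"
    and "hexpath_dist k v (2 * k + 10) = gap (k + 2) v + (if v = k + 2 \<or> v = k + 3 then 2 else 0)"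
    and "hexpath_dist k v (2 * k + 11) = gap (k + 3) v + (if v = k + 2 \<or> v = k + 3 then 2 else 0)"
  using hexpath_dist_to_spine[OF assms] by (simp_all only: hexpath_dist_commute[of k v])

lemma hexpath_vertex_cases:
  fixes v k :: nat
  assumes "v < 2 * k + 12"
  obtains "v \<le> 2 * k + 8" | "v = 2 * k + 9" | "v = 2 * k + 10" | "v = 2 * k + 11"
  using assms by linarith

lemma hexpath_dist_arc:
  assumes "(u, w) \<in> hexpath_edges k" "v < 2 * k + 12"
  shows "hexpath_dist k u v \<le> hexpath_dist k w v + 1 \<and> hexpath_dist k w v \<le> hexpath_dist k u v + 1"
proof -
  note facts = hexpath_dist_to_spine hexpath_dist_from_spine hexpath_dist_extra hexpath_dist_self
  consider "w = Suc u" "u < 2 * k + 8" |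
    "(u, w) \<in> {(k, 2 * k + 9), (k + 1, 2 * k + 9), (k + 2, 2 * k + 9),
      (k + 1, 2 * k + 10), (2 * k + 10, 2 * k + 11), (k + 4, 2 * k + 11)}"
    using assms(1) by (auto simp: hexpath_edges_def)
  then show ?thesis
  proof cases
    case 1
    from assms(2) show ?thesis
      by (cases rule: hexpath_vertex_cases) (use 1 in \<open>auto simp: facts gap_def\<close>)
  next
    case 2
    from assms(2) show ?thesis
      by (cases rule: hexpath_vertex_cases) (use 2 in \<open>auto simp: facts gap_def\<close>)
  qed
qed

lemma hexpath_edges_intros:
  "w = Suc u \<Longrightarrow> u < 2 * k + 8 \<Longrightarrow> (u, w) \<in> hexpath_edges k"
  "u = k \<or> u = k + 1 \<or> u = k + 2 \<Longrightarrow> (u, 2 * k + 9) \<in> hexpath_edges k"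
  "u = k + 1 \<Longrightarrow> (u, 2 * k + 10) \<in> hexpath_edges k"
  "u = k + 4 \<or> u = 2 * k + 10 \<Longrightarrow> (u, 2 * k + 11) \<in> hexpath_edges k"
  by (auto simp: hexpath_edges_def)

text \<open>
  The next vertex on a geodesic.  On the spine it is the neighbour on the side of the position of the
  target, except next to an additional vertex and inside the hexagon, where the geodesic leaves the spine
  or first moves towards the end of the hexagon through which the target is reached.
\<close>
lemma hexpath_dist_descent:
  assumes "u < 2 * k + 12" "v < 2 * k + 12" "u \<noteq> v"
  shows "\<exists>w. ((u, w) \<in> hexpath_edges k \<or> (w, u) \<in> hexpath_edges k) \<and> hexpath_dist k w v < hexpath_dist k u v"
    (is "\<exists>w. ?good w")
proof -
  let ?A = "2 * k + 9" and ?B = "2 * k + 10" and ?C = "2 * k + 11"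
  note simps = hexpath_edges_intros hexpath_dist_to_spine hexpath_dist_from_spine hexpath_dist_extra hexpath_dist_self
  from assms(1) show ?thesis
  proof (cases rule: hexpath_vertex_cases)
    case u: 1
    from assms(2) show ?thesis
    proof (cases rule: hexpath_vertex_cases)
      case 1
      with u assms(3) show ?thesis
        by (intro exI[of _ "if v < u then u - 1 else u + 1"]) (auto simp: simps gap_def)
    next
      case 2
      consider "u < k" | "u \<in> {k, k + 1, k + 2}" | "u > k + 2" by fastforce
      then show ?thesis
      proof cases
        assume "u < k"
        then have "?good (Suc u)" using u 2 by (auto simp: simps gap_def)
        then show ?thesis ..
      next
        assume "u \<in> {k, k + 1, k + 2}"
        then have "?good ?A" using u 2 by (auto simp: simps gap_def)
        then show ?thesis ..
      next
        assume "u > k + 2"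
        then have "?good (u - 1)" using u 2 by (auto simp: simps gap_def)
        then show ?thesis ..
      qed
    next
      case 3
      consider "u \<le> k" | "u = k + 1" | "u = k + 2 \<or> u = k + 3 \<or> u > k + 4" | "u = k + 4" by linarith
      then show ?thesis
      proof cases
        assume "u \<le> k"
        then have "?good (Suc u)" using u 3 by (auto simp: simps gap_def)
        then show ?thesis ..
      next
        assume "u = k + 1"
        then have "?good ?B" using u 3 by (auto simp: simps gap_def)
        then show ?thesis ..
      next
        assume "u = k + 2 \<or> u = k + 3 \<or> u > k + 4"
        then have "?good (u - 1)" using u 3 by (auto simp: simps gap_def)
        then show ?thesis ..
      next
        assume "u = k + 4"
        then have "?good ?C" using u 3 by (auto simp: simps gap_def)
        then show ?thesis ..
      qed
    next
      case 4
      consider "u \<le> k \<or> u = k + 2 \<or> u = k + 3" | "u = k + 1" | "u > k + 4" | "u = k + 4" by linarith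
      then show ?thesis
      proof cases
        assume "u \<le> k \<or> u = k + 2 \<or> u = k + 3"
        then have "?good (Suc u)" using u 4 by (auto simp: simps gap_def)
        then show ?thesis ..
      next
        assume "u = k + 1"
        then have "?good ?B" using u 4 by (auto simp: simps gap_def)
        then show ?thesis ..
      next
        assume "u > k + 4"
        then have "?good (u - 1)" using u 4 by (auto simp: simps gap_def)
        then show ?thesis ..
      next
        assume "u = k + 4"
        then have "?good ?C" using u 4 by (auto simp: simps gap_def)
        then show ?thesis ..
      qed
    qed
  next
    case u: 2
    from assms(2) show ?thesis
    proof (cases rule: hexpath_vertex_cases)
      case 1
      with u show ?thesis
        by (intro exI[of _ "if v \<le> k then k else if v = k + 1 then k + 1 else k + 2"])
          (auto simp: simps gap_def)
    next
      case 2
      with u assms(3) show ?thesis by simp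
    next
      case 3
      with u have "?good (k + 1)" by (auto simp: simps gap_def)
      then show ?thesis ..
    next
      case 4
      with u have "?good (k + 1)" by (auto simp: simps gap_def)
      then show ?thesis ..
    qed
  next
    case u: 3
    from assms(2) show ?thesis
    proof (cases rule: hexpath_vertex_cases)
      case 1
      with u show ?thesis
        by (intro exI[of _ "if v \<le> k + 3 then k + 1 else ?C"]) (auto simp: simps gap_def)
    next
      case 2
      with u have "?good (k + 1)" by (auto simp: simps gap_def)
      then show ?thesis ..
    next
      case 3
      with u assms(3) show ?thesis by simp
    next
      case 4
      with u have "?good ?C" by (auto simp: simps gap_def)
      then show ?thesis ..
    qed
  next
    case u: 4
    from assms(2) show ?thesis
    proof (cases rule: hexpath_vertex_cases)
      case 1
      with u show ?thesis
        by (intro exI[of _ "if v \<le> k + 1 then ?B else k + 4"]) (auto simp: simps gap_def)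
    next
      case 2
      with u have "?good ?B" by (auto simp: simps gap_def)
      then show ?thesis ..
    next
      case 3
      with u have "?good ?B" by (auto simp: simps gap_def)
      then show ?thesis ..
    next
      case 4
      with u assms(3) show ?thesis by simp
    qed
  qed
qed

section \<open>Transmissions of vertices and edges\<close>

text \<open>
  The spine contributes the sum of the gaps from a position on a path.  The remaining part \<open>X\<close>, made of the
  three additional vertices and the detours, is linear on the arms and
  independent of \<open>k\<close> at the vertices between them.
\<close>
lemma hexpath_transmission_eq:
  assumes "v < 2 * k + 12"
  shows "(\<Sum>u<2 * k + 12. hexpath_dist k v u) = hexpath_transmission k v"
proof -
  define P where "P = hexpath_pos k v"
  have P: "P \<le> 2 * k + 8"
    using assms by (auto simp: P_def hexpath_pos_def)
  have "{..<2 * k + 12} = {..<2 * k + 9} \<union> {2 * k + 9, 2 * k + 10, 2 * k + 11}"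
    by auto
  then have "(\<Sum>u<2 * k + 12. hexpath_dist k v u) = (\<Sum>u<2 * k + 9. hexpath_dist k v u) +
      (hexpath_dist k v (2 * k + 9) + hexpath_dist k v (2 * k + 10) + hexpath_dist k v (2 * k + 11))"
    by (simp add: sum.union_disjoint)
  also have "(\<Sum>u<2 * k + 9. hexpath_dist k v u) =
      (\<Sum>u<2 * k + 9. gap P u) + (\<Sum>u<2 * k + 9. hexpath_detour k v u)"
    by (simp add: sum.distrib[symmetric] hexpath_dist_def hexpath_pos_def P_def)
  also have "(\<Sum>u<2 * k + 9. hexpath_detour k v u) = (\<Sum>u\<in>{k + 1, k + 2, k + 3}. hexpath_detour k v u)"
    by (rule sum.mono_neutral_right) (auto simp: hexpath_detour_def)
  finally have eq: "(\<Sum>u<2 * k + 12. hexpath_dist k v u) = (\<Sum>u<2 * k + 9. gap P u) +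
      (hexpath_detour k v (k + 1) + hexpath_detour k v (k + 2) + hexpath_detour k v (k + 3)) +
      (hexpath_dist k v (2 * k + 9) + hexpath_dist k v (2 * k + 10) + hexpath_dist k v (2 * k + 11))"
    by simp
  define X where "X =
      (hexpath_detour k v (k + 1) + hexpath_detour k v (k + 2) + hexpath_detour k v (k + 3)) +
      (hexpath_dist k v (2 * k + 9) + hexpath_dist k v (2 * k + 10) + hexpath_dist k v (2 * k + 11))"
  have total: "2 * (\<Sum>u<2 * k + 12. hexpath_dist k v u) = P * Suc P + r * Suc r + 2 * X"
    if "P + r = 2 * k + 8" for r
  proof -
    have "Suc (P + r) = 2 * k + 9"
      using that by simp
    with gap_sum_path[of P r] have "2 * (\<Sum>u<2 * k + 9. gap P u) = P * Suc P + r * Suc r"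
      by (simp only:)
    then show ?thesis
      unfolding eq X_def by (simp only: distrib_left add.assoc)
  qed
  note defs = P_def hexpath_pos_def X_def hexpath_detour_def hexpath_dist_def gap_def
  consider (L) "v \<le> k" | (R) "k + 4 \<le> v" "v \<le> 2 * k + 8"
    | "v = k + 1" | "v = k + 2" | "v = k + 3"
    | "v = 2 * k + 9" | "v = 2 * k + 10" | "v = 2 * k + 11"
    using assms by linarith
  then have "2 * (\<Sum>u<2 * k + 12. hexpath_dist k v u) = 2 * hexpath_transmission k v"
  proof cases
    case L
    then obtain s where s: "k = v + s" using le_Suc_ex by blast
    have "P = v" "X = 3 * s + 6"
      unfolding s by (simp_all add: defs s)
    then show ?thesis
      using total[of "v + 2 * s + 8"]
      by (simp add: s hexpath_transmission_def power2_eq_square algebra_simps)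
  next
    case R
    then obtain s where s: "v = k + 4 + s" using le_Suc_ex by blast
    obtain r where r: "k + 4 = s + r" using R(2) s le_Suc_ex[of s "k + 4"] by auto
    have P: "P = v" and X: "X = 3 * s + 6"
      using R(2) by (simp_all add: defs s)
    have v: "v = 2 * s + r"
      using s r by simp
    have "2 * (\<Sum>u<2 * k + 12. hexpath_dist k v u) = v * Suc v + r * Suc r + 2 * (3 * s + 6)"
      using total[of r] P X s r by simp
    also have "\<dots> = 4 * s\<^sup>2 + 4 * (s * r) + 2 * r\<^sup>2 + 8 * s + 2 * r + 12"
      unfolding v by (simp add: power2_eq_square algebra_simps)
    also have "\<dots> = 2 * (k + 4)\<^sup>2 + 2 * (k + 4) + 2 * s\<^sup>2 + 6 * s + 12"
      unfolding r by (simp add: power2_eq_square algebra_simps)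
    also have "\<dots> = 2 * hexpath_transmission k v"
      using R(2) by (simp add: hexpath_transmission_def s power2_eq_square algebra_simps)
    finally show ?thesis .
  next
    case 3
    then have "P = k + 1" "X = 4" by (simp_all add: defs)
    then show ?thesis
      using total[of "k + 7"] 3 by (simp add: hexpath_transmission_def power2_eq_square algebra_simps)
  next
    case 4
    then have "P = k + 2" "X = 6" by (simp_all add: defs)
    then show ?thesis
      using total[of "k + 6"] 4 by (simp add: hexpath_transmission_def power2_eq_square algebra_simps)
  next
    case 5
    then have "P = k + 3" "X = 7" by (simp_all add: defs)
    then show ?thesis
      using total[of "k + 5"] 5 by (simp add: hexpath_transmission_def power2_eq_square algebra_simps)
  next
    case 6
    then have "P = k + 1" "X = 6" by (simp_all add: defs)
    then show ?thesis
      using total[of "k + 7"] 6 by (simp add: hexpath_transmission_def power2_eq_square algebra_simps)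
  next
    case 7
    then have "P = k + 2" "X = 7" by (simp_all add: defs)
    then show ?thesis
      using total[of "k + 6"] 7 by (simp add: hexpath_transmission_def power2_eq_square algebra_simps)
  next
    case 8
    then have "P = k + 3" "X = 8" by (simp_all add: defs)
    then show ?thesis
      using total[of "k + 5"] 8 by (simp add: hexpath_transmission_def power2_eq_square algebra_simps)
  qed
  then show ?thesis by simp
qed

text \<open>
  The shift of \<open>z\<close> by \<open>6\<close> comes from completing the square: \<open>s\<close> steps to the left of \<open>k\<close> the transmission is
  \<open>Q + (s + 2) * (s + 9)\<close>, and two consecutive values add up to \<open>2 * Q + 2 * (s + 6)\<^sup>2 - 24\<close>.
\<close>
lemma hexpath_edge_weight_cases:
  assumes "(u, v) \<in> hexpath_edges k"
  obtains
    (left) z where "z \<ge> 6" "u + z = k + 5" "v = Suc u"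
      "hexpath_transmission k u + hexpath_transmission k v + 24 = 2 * (k\<^sup>2 + 9 * k + 24) + 2 * z\<^sup>2"
  | (right) y where "y \<ge> 2" "u = k + 2 + y" "v = Suc u"
      "hexpath_transmission k u + hexpath_transmission k v = 2 * (k\<^sup>2 + 9 * k + 24) + 2 * y\<^sup>2"
  | (core) c where "hexpath_transmission k u + hexpath_transmission k v = 2 * (k\<^sup>2 + 9 * k + 24) + c"
      "(u, v, c) \<in> {(k, k + 1, 27), (k + 1, k + 2, 15), (k + 2, k + 3, 10), (k + 3, k + 4, 6),
        (k, 2 * k + 9, 29), (k + 1, 2 * k + 9, 20), (k + 2, 2 * k + 9, 17),
        (k + 1, 2 * k + 10, 16), (2 * k + 10, 2 * k + 11, 12), (k + 4, 2 * k + 11, 7)}"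
proof -
  consider (path) "v = Suc u" "u < 2 * k + 8" |
    (extra) "(u, v) \<in> {(k, 2 * k + 9), (k + 1, 2 * k + 9), (k + 2, 2 * k + 9),
        (k + 1, 2 * k + 10), (2 * k + 10, 2 * k + 11), (k + 4, 2 * k + 11)}"
    using assms by (auto simp: hexpath_edges_def)
  then show thesis
  proof cases
    case path
    consider (L) "u < k" | (R) "k + 4 \<le> u" | "u = k" | "u = k + 1" | "u = k + 2" | "u = k + 3"
      by linarith
    then show thesis
    proof cases
      case L
      then obtain s where s: "k = u + s + 1" using less_iff_Suc_add by auto
      show thesis
        by (rule left[of "s + 6"])
          (simp_all add: path s hexpath_transmission_def power2_eq_square algebra_simps)
    next
      case R
      then obtain s where s: "u = k + 4 + s" using le_Suc_ex by blast
      show thesis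
        by (rule right[of "s + 2"])
          (use path in \<open>simp_all add: s hexpath_transmission_def power2_eq_square algebra_simps\<close>)
    qed (rule core, simp_all add: path hexpath_transmission_def)+
  next
    case extra
    then show thesis
      by (elim insertE emptyE; intro core) (simp_all add: hexpath_transmission_def)
  qed
qed

text \<open>
  Squares at distance \<open>12\<close> have roots of equal parity, so these are at least \<open>2\<close> apart, which forces them to
  be small.  The bound on \<open>z\<close> excludes the solution \<open>16 = 4 + 12\<close>.
\<close>
lemma squares_not_apart_by_12:
  fixes y z :: nat
  assumes "z \<ge> 6"
  shows "z\<^sup>2 \<noteq> y\<^sup>2 + 12"
proof
  assume eq: "z\<^sup>2 = y\<^sup>2 + 12"
  then have "y < z"
    by (metis add_gr_0 less_add_same_cancel1 power_less_imp_less_base zero_le zero_less_numeral)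
  moreover have "y + 1 \<noteq> z"
  proof
    assume "y + 1 = z"
    with eq have "2 * y = 11" by (auto simp: power2_eq_square)
    then show False by presburger
  qed
  ultimately have "y + 2 \<le> z" by simp
  then have "(y + 2)\<^sup>2 \<le> z\<^sup>2" by (rule power_mono) simp
  with eq have "y \<le> 2" by (simp add: power2_eq_square)
  then have "y\<^sup>2 \<le> 2\<^sup>2" by (rule power_mono) simp
  moreover have "6\<^sup>2 \<le> z\<^sup>2" using assms by (rule power_mono) simp
  ultimately show False using eq by simp
qed

lemma hexpath_weight_inj:
  "inj_on (\<lambda>(u, v). hexpath_transmission k u + hexpath_transmission k v) (hexpath_edges k)"
proof (rule inj_onI, clarify)
  fix u v u' v'
  assume E: "(u, v) \<in> hexpath_edges k" "(u', v') \<in> hexpath_edges k"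
    and eq: "hexpath_transmission k u + hexpath_transmission k v =
      hexpath_transmission k u' + hexpath_transmission k v'"
  have big: "36 \<le> z\<^sup>2" if "z \<ge> 6" for z :: nat
    using power_mono[OF that, of 2] by simp
  have small: "y\<^sup>2 = 4 \<or> y\<^sup>2 = 9 \<or> y\<^sup>2 \<ge> 16" if y: "y \<ge> 2" for y :: nat
  proof -
    consider "y = 2" | "y = 3" | "y \<ge> 4" using y by linarith
    then show ?thesis using power_mono[of 4 y 2] by cases auto
  qed
  from E(1) show "u = u' \<and> v = v'"
  proof (cases rule: hexpath_edge_weight_cases)
    case L: (left z)
    from E(2) show ?thesis
    proof (cases rule: hexpath_edge_weight_cases)
      case (left z')
      with L eq have "z\<^sup>2 = z'\<^sup>2" by linarith
      with L left show ?thesis by simp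
    next
      case (right y)
      with L eq have "z\<^sup>2 = y\<^sup>2 + 12" by linarith
      with squares_not_apart_by_12 L(1) show ?thesis by blast
    next
      case (core c)
      with L eq big[of z] show ?thesis by auto
    qed
  next
    case R: (right y)
    from E(2) show ?thesis
    proof (cases rule: hexpath_edge_weight_cases)
      case (left z)
      with R eq have "z\<^sup>2 = y\<^sup>2 + 12" by linarith
      with squares_not_apart_by_12 left(1) show ?thesis by blast
    next
      case (right y')
      with R eq have "y\<^sup>2 = y'\<^sup>2" by linarith
      with R right show ?thesis by simp
    next
      case (core c)
      with R eq small[OF R(1)] have "c = 8 \<or> c = 18 \<or> c \<ge> 32" by linarith
      with core(2) show ?thesis by auto
    qed
  next
    case C: (core c)
    from E(2) show ?thesis
    proof (cases rule: hexpath_edge_weight_cases)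
      case (left z)
      with C eq big[of z] show ?thesis by auto
    next
      case (right y)
      with C eq small[OF right(1)] have "c = 8 \<or> c = 18 \<or> c \<ge> 32" by linarith
      with C(2) show ?thesis by auto
    next
      case (core c')
      with C eq have "c = c'" by linarith
      with C(2) core(2) show ?thesis by auto
    qed
  qed
qed

lemma hexpath_degree: "card {u. (u, v) \<in> hexpath_edges k \<or> (v, u) \<in> hexpath_edges k} \<le> 4"
  (is "card ?N \<le> 4")
proof -
  have bound: "card ?N \<le> 4" if "?N \<subseteq> set xs" "length xs \<le> 4" for xs
    using card_mono[OF _ that(1)] card_length[of xs] that(2) by simp
  consider "v = k + 1" | "v = 2 * k + 9" | "v = 2 * k + 10" | "v = 2 * k + 11"
    | "v \<notin> {k + 1, 2 * k + 9, 2 * k + 10, 2 * k + 11}" by blast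
  then show ?thesis
  proof cases
    case 1
    then show ?thesis
      by (intro bound[of "[k, k + 2, 2 * k + 9, 2 * k + 10]"]) (auto simp: hexpath_edges_def)
  next
    case 2
    then show ?thesis
      by (intro bound[of "[k, k + 1, k + 2]"]) (auto simp: hexpath_edges_def)
  next
    case 3
    then show ?thesis
      by (intro bound[of "[k + 1, 2 * k + 11]"]) (auto simp: hexpath_edges_def)
  next
    case 4
    then show ?thesis
      by (intro bound[of "[2 * k + 10, k + 4]"]) (auto simp: hexpath_edges_def)
  next
    case 5
    then show ?thesis
      by (intro bound[of "[v - 1, v + 1, 2 * k + 9, 2 * k + 11]"]) (auto simp: hexpath_edges_def)
  qed
qed

section \<open>Order ten\<close>

definition comb_edges :: "(nat \<times> nat) list" where
  "comb_edges = [(0, 1), (1, 2), (2, 3), (3, 4), (4, 5), (5, 6), (6, 7), (2, 8), (4, 9)]"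

definition comb_foot :: "nat \<Rightarrow> nat" where
  "comb_foot v = (if v = 8 then 2 else if v = 9 then 4 else v)"

text \<open>
  The gap between the feet on the path plus the heights above it.
\<close>
definition comb_dist :: "nat \<Rightarrow> nat \<Rightarrow> nat" where
  "comb_dist u v = (if u = v then 0 else
     gap (comb_foot u) (comb_foot v) + (if u < 8 then 0 else 1) + (if v < 8 then 0 else 1))"

text \<open>
  Everything to be checked is a statement about the ten numbers below \<open>10\<close>.  It is phrased with lists and
  bounded quantifiers, so that rewriting with code equations decides it.
\<close>
lemma comb_edges_bounds: "\<forall>(u, v) \<in> set comb_edges. u < 10 \<and> v < 10 \<and> u \<noteq> v"
  by code_simp

lemma comb_degree:
  "\<forall>v \<in> set [0..<10].
     card (set (filter (\<lambda>u. (u, v) \<in> set comb_edges \<or> (v, u) \<in> set comb_edges) [0..<10])) \<le> 4"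
  by code_simp

lemma comb_dist_arc:
  "\<forall>v \<in> set [0..<10]. \<forall>(u, w) \<in> set comb_edges.
     comb_dist u v \<le> comb_dist w v + 1 \<and> comb_dist w v \<le> comb_dist u v + 1"
  by code_simp

lemma comb_dist_descent:
  "\<forall>v \<in> set [0..<10]. \<forall>u \<in> set [0..<10]. u = v \<or>
     (\<exists>w \<in> set [0..<10]. ((u, w) \<in> set comb_edges \<or> (w, u) \<in> set comb_edges) \<and>
        comb_dist w v < comb_dist u v)"
  by code_simp

lemma comb_weight_distinct:
  "distinct (map (\<lambda>(u, v). sum_list (map (comb_dist u) [0..<10]) + sum_list (map (comb_dist v) [0..<10]))
     comb_edges)"
  by code_simp

lemma exists_chemical_eti_graph_of_order_10:
  "\<exists>G :: nat pair_pre_digraph.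
    chemical_graph G \<and> edge_transmission_irregular G \<and> card (pverts G) = 10"
proof -
  have "metric_certificate (graph_of 10 (set comb_edges)) comb_dist"
    unfolding metric_certificate_def
  proof (intro ballI conjI impI)
    fix v assume "v \<in> pverts (graph_of 10 (set comb_edges))"
    then have v: "v \<in> set [0..<10]" by simp
    show "comb_dist v v = 0" by (simp add: comb_dist_def)
    show "case e of (u, w) \<Rightarrow> comb_dist u v \<le> comb_dist w v + 1"
      if "e \<in> parcs (graph_of 10 (set comb_edges))" for e
      using bspec[OF comb_dist_arc v] that by auto
    show "\<exists>w. (u, w) \<in> parcs (graph_of 10 (set comb_edges)) \<and> comb_dist w v < comb_dist u v"
      if "u \<in> pverts (graph_of 10 (set comb_edges))" "u \<noteq> v" for u
      using bspec[OF bspec[OF comb_dist_descent v], of u] that by auto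
  qed
  moreover have "card {u. (u, v) \<in> set comb_edges \<or> (v, u) \<in> set comb_edges} \<le> 4" if "v < 10" for v
  proof -
    have "{u. (u, v) \<in> set comb_edges \<or> (v, u) \<in> set comb_edges} =
        set (filter (\<lambda>u. (u, v) \<in> set comb_edges \<or> (v, u) \<in> set comb_edges) [0..<10])"
      using comb_edges_bounds by auto
    then show ?thesis
      using bspec[OF comb_degree, of v] that by simp
  qed
  moreover have "inj_on (\<lambda>(u, v). (\<Sum>w<10. comb_dist u w) + (\<Sum>w<10. comb_dist v w)) (set comb_edges)"
    using comb_weight_distinct
    by (simp add: distinct_map interv_sum_list_conv_sum_set_nat atLeast0LessThan)
  ultimately show ?thesis
    by (intro chemical_eti_graph_of[of 10 "set comb_edges" comb_dist "\<lambda>v. \<Sum>w<10. comb_dist v w"])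
      (use comb_edges_bounds in auto)
qed

section \<open>All even orders\<close>

theorem theorem4p6:
  fixes n :: nat
  assumes "even n" and "n \<ge> 10"
  shows "\<exists>G :: nat pair_pre_digraph.
    chemical_graph G \<and> edge_transmission_irregular G \<and> card (pverts G) = n"
proof (cases "n = 10")
  case True
  then show ?thesis using exists_chemical_eti_graph_of_order_10 by simp
next
  case False
  with assms obtain k where n: "n = 2 * k + 12"
  proof -
    from assms False have "n - 12 = 2 * ((n - 12) div 2)" "n \<ge> 12" by presburger+
    then show thesis by (intro that[of "(n - 12) div 2"]) linarith
  qed
  have "metric_certificate (graph_of n (hexpath_edges k)) (hexpath_dist k)"
    using hexpath_dist_arc hexpath_dist_descent
    by (auto simp: n metric_certificate_def hexpath_dist_self)
  then show ?thesis
    unfolding n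
    by (intro chemical_eti_graph_of[of _ "hexpath_edges k" "hexpath_dist k" "hexpath_transmission k"])
      (auto simp: hexpath_edges_bounds hexpath_degree hexpath_transmission_eq hexpath_weight_inj)
qed

end
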